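(* For $x>0$ let $$V(x)=x\,\{H(x)-\log x-\gamma+2\}-\frac12\log x+\sum_{1\le n\le x}\log n-\lfloor x\rfloor(1+\log x)-\frac12\log 2\pi-\frac12,$$ where the braces in this formula are ordinary grouping brackets (not a fractional part). Then for every real $r>0$, $$S_2(r)=\int_r^\infty S_1(t)\left(\frac1t-\frac1r\right)dt,$$ $$\int_r^\infty S_1(t)\,dt=\sum_{n\ge1}\frac{V(nr)}{n}.$$
   Context: Notation: $H(x)=\sum_{1\le k\le x}1/k$ for $x>0$ (empty sums are $0$); $\lfloor x\rfloor$ is the largest integer $\le x$; in the formula for $R_1$ below $\{x\}=x-\lfloor x\rfloor$ is the fractional part; $\log^2x=(\log x)^2$; $\gamma$, $\gamma_1$ are the first two Stieltjes constants: $\zeta(s)=\frac1{s-1}+\gamma-\gamma_1(s-1)+O((s-1)^2)$ as $s\to1$. For $x>0$, $$R_1(x)=\log x+\gamma-H(x)-\frac{\{x\}-1/2}{x},$$ $$R_2(x)=\frac1x\left(\frac12\log 2\pi+1+\frac12\log x\right)+(2-\gamma)\log x-\frac12\log^2x+2\gamma+\gamma_1-3+\frac1x\sum_{1\le\ell\le x}\left[\left(1+\frac x\ell\right)\log\frac x\ell+2\left(1-\frac x\ell\right)\right],$$ and $S_q(x)=\sum_{k\ge1}R_q(kx)$ for $q=1,2$ (absolutely convergent for every $x>0$). *)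

theory Defs
  imports "HOL-Complex_Analysis.Complex_Analysis" "HOL-Library.Landau_Symbols"
begin

section \<open>The Riemann zeta function near its pole\<close>

text \<open>
  Only the behaviour at \<open>s = 1\<close> is needed, so the analytic continuation is taken to the punctured
  half-plane \<open>Re s > 0\<close>, \<open>s \<noteq> 1\<close>; \<open>zeta_continuation\<close> shows that it exists
  (it is unique there, the domain being connected).
  Values outside this domain are unspecified.
\<close>

definition zeta_domain :: "complex set" where
  "zeta_domain = {s. Re s > 0} - {1}"

definition zeta :: "complex \<Rightarrow> complex" where
  "zeta = (SOME f. f holomorphic_on zeta_domain \<and>
     (\<forall>s. Re s > 1 \<longrightarrow> (\<lambda>n. 1 / of_nat (Suc n) powr s) sums f s))"

text \<open>
  The Stieltjes constant \<open>\<gamma>\<^sub>1\<close>, read off from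
  \<open>\<zeta>(s) = 1/(s - 1) + \<gamma> - \<gamma>\<^sub>1 (s - 1) + O((s - 1)\<^sup>2)\<close>, where \<open>\<gamma>\<close> is the
  Euler-Mascheroni constant. Existence and uniqueness are \<open>zeta_expansion\<close> and
  \<open>zeta_expansion_unique\<close> below.
\<close>

definition stieltjes_gamma1 :: real where
  "stieltjes_gamma1 = (THE c::real.
     (\<lambda>s. zeta s - (1 / (s - 1) + of_real euler_mascheroni - of_real c * (s - 1)))
       \<in> O[at 1](\<lambda>s. (s - 1)\<^sup>2))"

text \<open>
  For \<open>Re s > 1\<close> the last two terms telescope, so these functions sum to \<open>(s - 1) \<zeta>(s) - 1\<close>;
  the series converges locally uniformly on \<open>Re s > 0\<close>, including \<open>s = 1\<close>.
\<close>

definition zeta_aux :: "nat \<Rightarrow> complex \<Rightarrow> complex" where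
  "zeta_aux n s = (s - 1) * of_nat (Suc n) powr (-s)
     + of_nat (n + 2) powr (1 - s) - of_nat (Suc n) powr (1 - s)"

definition zeta_aux_deriv :: "nat \<Rightarrow> complex \<Rightarrow> complex" where
  "zeta_aux_deriv n s = of_nat (Suc n) powr (-s)
     - (s - 1) * of_nat (Suc n) powr (-s) * Ln (of_nat (Suc n))
     - of_nat (n + 2) powr (1 - s) * Ln (of_nat (n + 2))
     + of_nat (Suc n) powr (1 - s) * Ln (of_nat (Suc n))"

lemma zeta_aux_has_deriv:
  "(zeta_aux n has_field_derivative zeta_aux_deriv n s) (at s)"
proof -
  define a b :: complex where "a = of_nat (Suc n)" and "b = of_nat (n + 2)"
  have ab: "a \<noteq> 0" "b \<noteq> 0" unfolding a_def b_def of_nat_eq_0_iff by simp_all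
  have powr: "((\<lambda>z. c powr f z) has_field_derivative c powr f s * Ln c * f') (at s)"
    if "c \<noteq> 0" "(f has_field_derivative f') (at s)" for c f f'
    using DERIV_chain2[OF has_field_derivative_powr_right[OF that(1)] that(2)]
    by (simp add: mult_ac)
  have "((\<lambda>s. (s - 1) * a powr (-s) + b powr (1 - s) - a powr (1 - s)) has_field_derivative
     (a powr (-s) - (s - 1) * a powr (-s) * Ln a - b powr (1 - s) * Ln b + a powr (1 - s) * Ln a)) (at s)"
    by (rule derivative_eq_intros powr ab refl)+ (simp add: algebra_simps)
  then show ?thesis
    unfolding zeta_aux_def [abs_def] zeta_aux_deriv_def a_def b_def .
qed

lemma norm_zeta_aux_le:
  assumes s: "Re s > 0"
  shows "norm (zeta_aux n s) \<le> norm (s - 1) * norm s * real (Suc n) powr (- Re s - 1)"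
proof -
  define a b :: complex where "a = of_nat (Suc n)" and "b = of_nat (n + 2)"
  define S where "S = closed_segment a b"
  define f where "f = (\<lambda>i::nat. if i = 0 then (\<lambda>z::complex. z powr (1 - s))
     else if i = 1 then (\<lambda>z. (1 - s) * z powr (-s))
     else (\<lambda>z. (1 - s) * (-s) * z powr (-s - 1)))"
  have S: "\<exists>t. z = of_real t \<and> real (Suc n) \<le> t" if "z \<in> S" for z
  proof -
    have "S = of_real ` {real (Suc n) .. real (n + 2)}"
      using closed_segment_of_real[of "real (Suc n)" "real (n + 2)", where 'a = complex]
      by (simp add: S_def a_def b_def closed_segment_eq_real_ivl del: of_nat_Suc of_nat_add)
    with that show ?thesis by auto
  qed
  have nonpos: "z \<notin> \<real>\<^sub>\<le>\<^sub>0" if "z \<in> S" for z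
    using S[OF that] by (auto simp: complex_nonpos_Reals_iff)
  have "norm (f 0 b - (\<Sum>i\<le>1. f i a * (b - a) ^ i / (fact i)))
          \<le> (norm (s - 1) * norm s * real (Suc n) powr (- Re s - 1)) * norm (b - a) ^ (Suc 1) / fact 1"
  proof (rule field_Taylor[where S = S])
    show "convex S" by (simp add: S_def)
    show "a \<in> S" "b \<in> S" by (auto simp: S_def)
    fix i :: nat and x assume x: "x \<in> S" and i: "i \<le> 1"
    show "(f i has_field_derivative f (Suc i) x) (at x within S)"
    proof (cases "i = 0")
      case True
      have "((\<lambda>z. z powr (1 - s)) has_field_derivative (1 - s) * x powr (1 - s - 1)) (at x within S)"
        by (rule has_field_derivative_at_within, rule has_field_derivative_powr) (use nonpos[OF x] in auto)
      then show ?thesis using True by (simp add: f_def)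
    next
      case False
      then have "i = 1" using i by simp
      have "((\<lambda>z. z powr (-s)) has_field_derivative (-s) * x powr (-s - 1)) (at x within S)"
        by (rule has_field_derivative_at_within, rule has_field_derivative_powr) (use nonpos[OF x] in auto)
      from DERIV_cmult[OF this, of "1 - s"] show ?thesis using \<open>i = 1\<close>
        by (simp add: f_def mult.assoc)
    qed
  next
    fix x assume x: "x \<in> S"
    then obtain t where t: "x = of_real t" "real (Suc n) \<le> t" using S by blast
    have "t > 0" using t(2) by simp
    have "norm (x powr (-s - 1)) = t powr (- Re s - 1)"
      using \<open>t > 0\<close> by (simp add: t(1) norm_powr_real_powr)
    also have "\<dots> \<le> real (Suc n) powr (- Re s - 1)"
      using t(2) s by (intro powr_mono2') auto
    finally have "norm (1 - s) * norm s * norm (x powr (-s - 1))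
       \<le> norm (1 - s) * norm s * real (Suc n) powr (- Re s - 1)"
      by (intro mult_left_mono) auto
    then show "norm (f (Suc 1) x) \<le> norm (s - 1) * norm s * real (Suc n) powr (- Re s - 1)"
      by (simp add: f_def norm_mult norm_minus_commute)
  qed
  moreover have "b - a = 1" by (simp add: a_def b_def)
  moreover have "f 0 b - (\<Sum>i\<le>1. f i a * 1 ^ i / (fact i)) = zeta_aux n s"
    unfolding zeta_aux_def
    by (simp add: f_def a_def b_def algebra_simps of_nat_1 [unfolded One_nat_def]
             del: of_nat_Suc of_nat_add)
  ultimately show ?thesis by simp
qed

lemma zeta_aux_suminf:
  obtains g g' where
    "\<And>s. Re s > 0 \<Longrightarrow> (\<lambda>n. zeta_aux n s) sums g s"
    "\<And>s. Re s > 0 \<Longrightarrow> (\<lambda>n. zeta_aux_deriv n s) sums g' s"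
    "\<And>s. Re s > 0 \<Longrightarrow> (g has_field_derivative g' s) (at s)"
proof -
  define S where "S = {s::complex. Re s > 0}"
  have "\<exists>g g'. \<forall>x\<in>S. ((\<lambda>n. zeta_aux n x) sums g x) \<and> ((\<lambda>n. zeta_aux_deriv n x) sums g' x)
      \<and> (g has_field_derivative g' x) (at x)"
  proof (rule series_and_derivative_comparison_complex)
    show "open S" unfolding S_def by (rule open_halfspace_Re_gt)
    show "(zeta_aux n has_field_derivative zeta_aux_deriv n x) (at x)" for n x
      by (rule zeta_aux_has_deriv)
    fix x assume "x \<in> S"
    then have x: "Re x > 0" by (simp add: S_def)
    define d where "d = Re x / 2"
    define C where "C = (norm x + d + 1) * (norm x + d)"
    define h where "h = (\<lambda>n. complex_of_real (C * real (Suc n) powr (- d - 1)))"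
    have d: "d > 0" using x by (simp add: d_def)
    then have C: "C \<ge> 0" by (simp add: C_def)
    have "summable (\<lambda>n. real (Suc n) powr (- d - 1))"
      using d by (subst summable_Suc_iff[where f = "\<lambda>n. real n powr (-d-1)"])
         (simp add: summable_real_powr_iff)
    then have "summable h" unfolding h_def
      by (intro summable_of_real summable_mult)
    moreover have "range h \<subseteq> \<real>\<^sub>\<ge>\<^sub>0" using C by (auto simp: h_def simp del: of_real_mult)
    moreover have "norm (zeta_aux n y) \<le> norm (h n)" if "y \<in> ball x d \<inter> S" for n y
    proof -
      have xy: "norm (y - x) < d" using that by (simp add: dist_norm norm_minus_commute)
      have "\<bar>Re (y - x)\<bar> < d" using abs_Re_le_cmod[of "y - x"] xy by linarith
      then have re: "Re y > d" by (simp add: d_def abs_if split: if_splits)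
      have ny: "norm y \<le> norm x + d" using norm_triangle_sub[of y x] xy by linarith
      have ny1: "norm (y - 1) \<le> norm x + d + 1" using norm_triangle_ineq4[of y 1] ny by simp
      have "norm (zeta_aux n y) \<le> norm (y - 1) * norm y * real (Suc n) powr (- Re y - 1)"
        using re d by (intro norm_zeta_aux_le) auto
      also have "\<dots> \<le> C * real (Suc n) powr (- d - 1)"
        unfolding C_def using ny ny1 re d
        by (intro mult_mono powr_mono) auto
      finally show ?thesis using C by (simp add: h_def norm_mult)
    qed
    ultimately show "\<exists>d h. 0 < d \<and> summable h \<and> range h \<subseteq> \<real>\<^sub>\<ge>\<^sub>0 \<and>
        (\<forall>\<^sub>F n in sequentially. \<forall>y\<in>ball x d \<inter> S. cmod (zeta_aux n y) \<le> cmod (h n))"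
      using d by (intro exI[of _ d] exI[of _ h]) auto
  qed
  then show ?thesis using that unfolding S_def by blast
qed

lemma zeta_continuation_aux:
  assumes g: "\<And>s. Re s > 0 \<Longrightarrow> (\<lambda>n. zeta_aux n s) sums g s" and s: "Re s > 1"
  shows "(\<lambda>n. 1 / of_nat (Suc n) powr s) sums ((1 + g s) / (s - 1))"
proof -
  have s1: "s \<noteq> 1" using s by auto
  have "(\<lambda>n. real (Suc n) powr (1 - Re s)) \<longlonglongrightarrow> 0"
    using s by (intro tendsto_neg_powr filterlim_compose[OF filterlim_real_sequentially filterlim_Suc]) auto
  then have "(\<lambda>n. of_nat (Suc n) powr (1 - s)) \<longlonglongrightarrow> (0::complex)"
  proof (rule Lim_null_comparison[rotated])
    have "norm (of_nat (Suc n) powr (1 - s)) = real (Suc n) powr (1 - Re s)" for n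
      using norm_powr_real_powr[of "of_nat (Suc n)" "1 - s"] by (simp del: of_nat_Suc)
    then show "\<forall>\<^sub>F n in sequentially. norm (of_nat (Suc n) powr (1 - s)) \<le> real (Suc n) powr (1 - Re s)"
      by simp
  qed
  from telescope_sums[OF this]
  have "(\<lambda>n. of_nat (n + 2) powr (1 - s) - of_nat (Suc n) powr (1 - s)) sums (0 - 1 :: complex)"
    by simp
  from sums_diff[OF g[of s] this] s
  have "(\<lambda>n. (s - 1) * of_nat (Suc n) powr (-s)) sums (g s + 1)"
    by (simp add: zeta_aux_def del: of_nat_Suc of_nat_add)
  from sums_divide[OF this, of "s - 1"] s1
  show ?thesis by (simp add: powr_minus_divide add.commute del: of_nat_Suc)
qed

lemma zeta_continuation:
  shows "zeta holomorphic_on zeta_domain"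
    and "Re s > 1 \<Longrightarrow> (\<lambda>n. 1 / of_nat (Suc n) powr s) sums zeta s"
proof -
  obtain g g' where g: "\<And>s. Re s > 0 \<Longrightarrow> (\<lambda>n. zeta_aux n s) sums g s"
    "\<And>s. Re s > 0 \<Longrightarrow> (g has_field_derivative g' s) (at s)"
    using zeta_aux_suminf by metis
  have "g holomorphic_on zeta_domain"
    unfolding zeta_domain_def by (rule holomorphic_onI)
      (use g(2) in \<open>auto simp: field_differentiable_def intro: has_field_derivative_at_within\<close>)
  then have "(\<lambda>s. (1 + g s) / (s - 1)) holomorphic_on zeta_domain"
    by (intro holomorphic_intros) (auto simp: zeta_domain_def)
  then have "\<exists>f. f holomorphic_on zeta_domain \<and>
     (\<forall>s. Re s > 1 \<longrightarrow> (\<lambda>n. 1 / of_nat (Suc n) powr s) sums f s)"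
    using zeta_continuation_aux[OF g(1)] by blast
  from someI_ex[OF this, folded zeta_def]
  show "zeta holomorphic_on zeta_domain"
    "Re s > 1 \<Longrightarrow> (\<lambda>n. 1 / of_nat (Suc n) powr s) sums zeta s" by auto
qed

lemma zeta_eq:
  assumes g: "\<And>s. Re s > 0 \<Longrightarrow> (\<lambda>n. zeta_aux n s) sums g s"
    "\<And>s. Re s > 0 \<Longrightarrow> (g has_field_derivative g' s) (at s)"
    and s: "s \<in> zeta_domain"
  shows "zeta s = (1 + g s) / (s - 1)"
proof (rule analytic_continuation_open[where f = zeta and g = "\<lambda>s. (1 + g s) / (s - 1)"])
  show "open {s. Re s > 1}" by (rule open_halfspace_Re_gt)
  show "open zeta_domain" unfolding zeta_domain_def
    by (intro open_Diff open_halfspace_Re_gt) auto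
  show "{s. Re s > 1} \<noteq> {}" by (auto intro: exI[of _ 2])
  have "connected {s. Re s > 0}" by (intro convex_connected convex_halfspace_Re_gt)
  then show "connected zeta_domain" unfolding zeta_domain_def
    by (intro connected_open_delete open_halfspace_Re_gt) auto
  show "{s. Re s > 1} \<subseteq> zeta_domain" by (auto simp: zeta_domain_def)
  show "zeta holomorphic_on zeta_domain" by (rule zeta_continuation)
  have "g holomorphic_on zeta_domain"
    unfolding zeta_domain_def by (rule holomorphic_onI)
      (use g(2) in \<open>auto simp: field_differentiable_def intro: has_field_derivative_at_within\<close>)
  then show "(\<lambda>s. (1 + g s) / (s - 1)) holomorphic_on zeta_domain"
    by (intro holomorphic_intros) (auto simp: zeta_domain_def)
  show "zeta z = (1 + g z) / (z - 1)" if "z \<in> {s. Re s > 1}" for z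
    using zeta_continuation(2)[of z] zeta_continuation_aux[of g z] g(1) that sums_unique2 by blast
qed (use s in auto)

lemma zeta_expansion_unique:
  assumes "(\<lambda>s. zeta s - (1 / (s - 1) + of_real euler_mascheroni - of_real c * (s - 1)))
       \<in> O[at 1](\<lambda>s. (s - 1)\<^sup>2)"
    and "(\<lambda>s. zeta s - (1 / (s - 1) + of_real euler_mascheroni - of_real c' * (s - 1)))
       \<in> O[at 1](\<lambda>s. (s - 1)\<^sup>2)"
  shows "c = (c'::real)"
proof -
  have "(\<lambda>s::complex. of_real (c - c') * (s - 1)) \<in> O[at 1](\<lambda>s. (s - 1)\<^sup>2)"
    using sum_in_bigo(2)[OF assms] by (simp add: algebra_simps)
  then obtain K where K: "eventually (\<lambda>s::complex. norm (of_real (c - c') * (s - 1)) \<le> K * norm ((s - 1)\<^sup>2)) (at 1)"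
    by (elim landau_o.bigE)
  have "eventually (\<lambda>s::complex. s \<noteq> 1) (at 1)" by (simp add: eventually_at_filter)
  with K have "eventually (\<lambda>s::complex. \<bar>c - c'\<bar> \<le> K * norm (s - 1)) (at 1)"
  proof eventually_elim
    case (elim s)
    then have "\<bar>c - c'\<bar> * norm (s - 1) \<le> (K * norm (s - 1)) * norm (s - 1)"
      by (simp add: norm_mult norm_power power2_eq_square mult.assoc flip: of_real_diff)
    moreover have "norm (s - 1) > 0" using elim by simp
    ultimately show ?case using mult_right_le_imp_le by blast
  qed
  moreover have "((\<lambda>s::complex. K * norm (s - 1)) \<longlongrightarrow> K * norm (1 - 1 :: complex)) (at 1)"
    by (intro tendsto_intros)
  ultimately have "\<bar>c - c'\<bar> \<le> 0"
    using tendsto_lowerbound by fastforce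
  then show ?thesis by simp
qed

lemma zeta_expansion:
  "(\<lambda>s. zeta s - (1 / (s - 1) + of_real euler_mascheroni - of_real stieltjes_gamma1 * (s - 1)))
     \<in> O[at 1](\<lambda>s. (s - 1)\<^sup>2)"
proof -
  obtain g g' where g: "\<And>s. Re s > 0 \<Longrightarrow> (\<lambda>n. zeta_aux n s) sums g s"
    "\<And>s. Re s > 0 \<Longrightarrow> (\<lambda>n. zeta_aux_deriv n s) sums g' s"
    "\<And>s. Re s > 0 \<Longrightarrow> (g has_field_derivative g' s) (at s)"
    using zeta_aux_suminf by metis
  define S where "S = {s::complex. Re s > 0}"
  have S: "open S" "1 \<in> S" by (auto simp: S_def open_halfspace_Re_gt)
  have hol: "g holomorphic_on S" unfolding S_def
    by (rule holomorphic_onI)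
      (use g(3) in \<open>auto simp: field_differentiable_def intro: has_field_derivative_at_within\<close>)
  have "(\<lambda>n. zeta_aux n 1) sums 0"
  proof -
    have "zeta_aux n 1 = 0" for n
      unfolding zeta_aux_def by (simp del: of_nat_Suc of_nat_add)
    then show ?thesis by simp
  qed
  then have g1: "g 1 = 0" using g(1)[of 1] sums_unique2 by fastforce
  have "zeta_aux_deriv n 1 = inverse (of_nat (n+1)) + of_real (ln (of_nat (n+1)))
     - of_real (ln (of_nat (n+2)))" for n
  proof -
    have "Ln (of_nat m) = of_real (ln (real m))" if "m > 0" for m
      using Ln_of_real[of "real m"] that by simp
    moreover have "of_nat (Suc n) powr (-1) = (inverse (of_nat (Suc n)) :: complex)"
      using powr_minus[of "of_nat (Suc n) :: complex" 1] by (simp del: of_nat_Suc)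
    moreover have "of_nat m powr (0::complex) = 1" if "m > 0" for m using that by simp
    ultimately show ?thesis
      unfolding zeta_aux_deriv_def by (simp del: of_nat_Suc of_nat_add powr_0)
  qed
  then have "(\<lambda>n. zeta_aux_deriv n 1) sums (of_real euler_mascheroni)"
    using euler_mascheroni_sum[where 'a = complex] by (simp add: of_real_euler_mascheroni)
  then have g'1: "g' 1 = of_real euler_mascheroni" using g(2)[of 1] sums_unique2 by fastforce

  define q where "q = (\<lambda>s. if s = 1 then deriv g 1 else (g s - g 1) / (s - 1))"
  have "q holomorphic_on S" unfolding q_def
    by (rule pole_lemma_open[OF hol S(1)])
  define p where "p = (\<lambda>s. if s = 1 then deriv q 1 else (q s - q 1) / (s - 1))"
  have hp: "p holomorphic_on S" unfolding p_def
    by (rule pole_lemma_open[OF \<open>q holomorphic_on S\<close> S(1)])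
  define r where "r = (\<lambda>s. if s = 1 then deriv p 1 else (p s - p 1) / (s - 1))"
  have hr: "r holomorphic_on S" unfolding r_def
    by (rule pole_lemma_open[OF hp S(1)])
  have q1: "q 1 = of_real euler_mascheroni"
    using DERIV_imp_deriv[OF g(3)[of 1]] g'1 by (simp add: q_def)
  have zeta_r: "zeta s - (1 / (s - 1) + of_real euler_mascheroni + p 1 * (s - 1)) = r s * (s - 1)\<^sup>2"
    if "s \<in> S - {1}" for s
  proof -
    have s: "s \<noteq> 1" "s - 1 \<noteq> 0" "s \<in> zeta_domain" using that by (auto simp: S_def zeta_domain_def)
    have "zeta s = (1 + g s) / (s - 1)" using zeta_eq[OF g(1) g(3) s(3)] .
    also have "\<dots> = 1 / (s - 1) + q s" using s(1) g1 by (simp add: q_def add_divide_distrib)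
    also have "q s = q 1 + p s * (s - 1)" using s by (simp add: p_def)
    also have "p s = p 1 + r s * (s - 1)" using s by (simp add: r_def)
    finally show ?thesis by (simp add: q1 algebra_simps power2_eq_square)
  qed

  have real: "p 1 \<in> \<real>"
  proof -
    have "isCont p 1" using hp S holomorphic_on_imp_continuous_on continuous_on_eq_continuous_at by blast
    moreover have "filterlim (\<lambda>n. 1 + of_real (1 / real (Suc n)) :: complex) (nhds (1 + of_real 0)) sequentially"
      by (intro tendsto_intros LIMSEQ_Suc[OF lim_1_over_n])
    ultimately have lim: "(\<lambda>n. p (1 + of_real (1 / real (Suc n)))) \<longlonglongrightarrow> p 1"
      by (intro isCont_tendsto_compose[of 1 p]) auto
    have "p (1 + of_real (1 / real (Suc n))) \<in> \<real>" for n
    proof -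
      define t where "t = 1 + 1 / real (Suc n)"
      have t: "t > 1" by (simp add: t_def)
      have "(\<lambda>n. Re (zeta_aux n (of_real t))) sums Re (g (of_real t))"
        using g(1)[of "of_real t"] t by (intro sums_Re) auto
      moreover have "zeta_aux n (of_real t) \<in> \<real>" for n
      proof -
        have "of_nat m powr of_real u \<in> (\<real> :: complex set)" for m u
          using powr_of_real[of "real m" u] by (metis Reals_of_real of_nat_0_le_iff of_real_of_nat_eq)
        from this[of _ "-t"] this[of _ "1 - t"] show ?thesis unfolding zeta_aux_def
          by (intro Reals_add Reals_diff Reals_mult) (simp_all del: of_nat_Suc of_nat_add)
      qed
      ultimately have "(\<lambda>n. of_real (Re (zeta_aux n (of_real t)))) sums (of_real (Re (g (of_real t))) :: complex)"
        by (simp only: sums_of_real_iff)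
      then have "g (of_real t) = of_real (Re (g (of_real t)))"
        using g(1)[of "of_real t"] t \<open>\<And>n. zeta_aux n (of_real t) \<in> \<real>\<close> sums_unique2 by (simp add: of_real_Re)
      then have "g (of_real t) \<in> \<real>" by (metis Reals_of_real)
      then have "q (of_real t) \<in> \<real>" using t g1 by (auto simp: q_def intro!: Reals_divide)
      moreover have "q 1 \<in> \<real>" unfolding q1 by (rule Reals_of_real)
      ultimately have "p (of_real t) \<in> \<real>" using t by (auto simp: p_def intro!: Reals_divide Reals_diff)
      then show ?thesis by (simp add: t_def)
    qed
    then show ?thesis using closed_sequentially[OF closed_complex_Reals _ lim] by blast
  qed
  define c where "c = - Re (p 1)"
  have c: "p 1 = - of_real c" using real by (simp add: c_def of_real_Re)
  have ev: "eventually (\<lambda>s. s \<in> S - {1}) (at 1)"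
    using S eventually_at_topological[of "\<lambda>s. s \<in> S - {1}" 1 UNIV] by auto
  have "isCont r 1" using hr S holomorphic_on_imp_continuous_on continuous_on_eq_continuous_at by blast
  then have "r \<in> O[at 1](\<lambda>_. 1)"
    by (intro bigoI_tendsto[of _ _ "r 1"]) (auto simp: isCont_def)
  then have "(\<lambda>s. r s * (s - 1)\<^sup>2) \<in> O[at 1](\<lambda>s. 1 * (s - 1)\<^sup>2)"
    by (intro landau_o.big.mult) auto
  moreover have "eventually (\<lambda>s. r s * (s - 1)\<^sup>2 =
      zeta s - (1 / (s - 1) + of_real euler_mascheroni - of_real c * (s - 1))) (at 1)"
    using ev by eventually_elim (use zeta_r c in simp)
  ultimately have *: "(\<lambda>s. zeta s - (1 / (s - 1) + of_real euler_mascheroni - of_real c * (s - 1)))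
       \<in> O[at 1](\<lambda>s. (s - 1)\<^sup>2)"
    by (simp add: landau_o.big.in_cong)
  show ?thesis unfolding stieltjes_gamma1_def
    by (rule theI[where a = c]) (use * zeta_expansion_unique in blast)+
qed


section \<open>The functions $H$, $R_q$, $S_q$ and $V$\<close>

text \<open>Sums over \<open>1 \<le> k \<le> x\<close> are taken over \<open>{1..nat \<lfloor>x\<rfloor>}\<close>, which is empty for \<open>x < 1\<close>.\<close>

definition H :: "real \<Rightarrow> real" where
  "H x = (\<Sum>k\<in>{1..nat \<lfloor>x\<rfloor>}. 1 / real k)"

definition R1 :: "real \<Rightarrow> real" where
  "R1 x = ln x + euler_mascheroni - H x - (frac x - 1/2) / x"

definition R2 :: "real \<Rightarrow> real" where
  "R2 x = 1/x * (1/2 * ln (2 * pi) + 1 + 1/2 * ln x)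
     + (2 - euler_mascheroni) * ln x - 1/2 * (ln x)\<^sup>2
     + 2 * euler_mascheroni + stieltjes_gamma1 - 3
     + 1/x * (\<Sum>l\<in>{1..nat \<lfloor>x\<rfloor>}. (1 + x / real l) * ln (x / real l) + 2 * (1 - x / real l))"

definition S1 :: "real \<Rightarrow> real" where
  "S1 x = (\<Sum>k. R1 (real (Suc k) * x))"

definition S2 :: "real \<Rightarrow> real" where
  "S2 x = (\<Sum>k. R2 (real (Suc k) * x))"

definition V :: "real \<Rightarrow> real" where
  "V x = x * (H x - ln x - euler_mascheroni + 2) - 1/2 * ln x
     + (\<Sum>n\<in>{1..nat \<lfloor>x\<rfloor>}. ln (real n))
     - of_int \<lfloor>x\<rfloor> * (1 + ln x) - 1/2 * ln (2 * pi) - 1/2"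

end

theory Submission
  imports Defs "HOL-Real_Asymp.Real_Asymp"
begin

text \<open>
  Away from the integers \<open>V' = - R\<^sub>1\<close> and \<open>R\<^sub>2' = V/x\<^sup>2\<close>; both functions are continuous, as their
  jumps at the integers cancel, and both vanish at infinity. The latter is where the constants come
  from: for \<open>V\<close> it is Stirling's formula, for \<open>R\<^sub>2\<close> the limit
  \<open>(\<Sum>k\<le>n. ln k / k) - (ln n)\<^sup>2/2 \<longlonglongrightarrow> \<gamma>\<^sub>1\<close>. Hence
  \<open>V x = \<integral>\<^sub>x\<^sup>\<infinity> R\<^sub>1\<close> and \<open>R\<^sub>2 x = \<integral>\<^sub>x\<^sup>\<infinity> R\<^sub>1(t) (1/t - 1/x) dt\<close>. Substituting \<open>x = k r\<close> and
  \<open>t = k u\<close> and summing over \<open>k\<close> gives both claims, sum and integral being interchangeable because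
  \<open>\<bar>R\<^sub>1 x\<bar> \<le> 3/x\<^sup>2\<close>.
\<close>

section \<open>Quadratic decay of \<open>R1\<close>\<close>

lemma H_eq_harm: "H x = harm (nat \<lfloor>x\<rfloor>)"
  by (simp add: H_def harm_def inverse_eq_divide)

text \<open>Euler's constant enclosed with the logarithm taken at m + 1, where m = floor x; the
  error lies between 1/(2(m+1)) and 1/(2m). This precision balances the term 1/(2x) in
  \<open>R1 x\<close> up to O(1/x^2).\<close>

lemma H_bounds:
  fixes x :: real
  assumes "x \<ge> 1"
  shows "euler_mascheroni + ln (real_of_int (\<lfloor>x\<rfloor> + 1)) - H x
           \<in> {1 / (2 * real_of_int (\<lfloor>x\<rfloor> + 1)) .. 1 / (2 * real_of_int \<lfloor>x\<rfloor>)}"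
proof -
  define m where "m = nat \<lfloor>x\<rfloor>"
  have "1 \<le> \<lfloor>x\<rfloor>" using assms by (simp add: le_floor_iff)
  then have m: "m \<ge> 1" "\<lfloor>x\<rfloor> = int m" unfolding m_def by linarith+
  show ?thesis
    using euler_mascheroni_bounds[OF m(1)]
    by (simp add: H_eq_harm m inverse_eq_divide add_ac algebra_simps)
qed

text \<open>For x >= 1 the inequality ln y <= y - 1, applied to x/u and to u/x with u = floor x + 1,
  bounds \<open>R1 x\<close> from above and below, and the terms of order 1/x cancel. For x < 1 the
  sum \<open>H x\<close> is empty and 1/x <= 1/x^2 absorbs each term. A bound on the whole half-line
  is wanted because r may be small.\<close>

lemma abs_R1_le:
  assumes "x > 0"
  shows "\<bar>R1 x\<bar> \<le> 3 / x\<^sup>2"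
proof (cases "x \<ge> 1")
  case True
  have "1 \<le> \<lfloor>x\<rfloor>" using True by (simp add: le_floor_iff)
  define m u where "m = real_of_int \<lfloor>x\<rfloor>" and "u = m + 1"
  \<comment> \<open>The bound x <= 2m comes from x < m + 1 and m >= 1; it later trades the factor 2m
    in a denominator for x.\<close>
  have m: "m \<ge> 1" "m \<le> x" "x < u" "x \<le> 2 * m" "u > 0" "x \<ge> 1"
    using True \<open>1 \<le> \<lfloor>x\<rfloor>\<close> unfolding m_def u_def by linarith+
  define \<theta> where "\<theta> = euler_mascheroni + ln u - H x"
  have \<theta>: "1 / (2 * u) \<le> \<theta>" "\<theta> \<le> 1 / (2 * m)"
    using H_bounds[OF True] by (auto simp: \<theta>_def u_def m_def)
  have R1: "R1 x = ln (x / u) + (u - x - 1/2) / x + \<theta>"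
    using m unfolding R1_def \<theta>_def frac_def m_def[symmetric]
    by (simp add: ln_div u_def diff_divide_distrib add_divide_distrib)
  have "ln (x / u) \<le> x / u - 1" by (rule ln_le_minus_one) (use m in auto)
  with R1 \<theta> have "R1 x \<le> x / u - 1 + (u - x - 1/2) / x + 1 / (2 * m)" by linarith
  also have "\<dots> = (u - x)\<^sup>2 / (x * u) + (x - m) / (2 * m * x)"
    using m by (simp add: field_simps power2_eq_square)
  also have "\<dots> \<le> 1 / (x * x) + 1 / (x * x)"
  proof (intro add_mono frac_le)
    show "(u - x)\<^sup>2 \<le> 1" using m by (intro power_le_one) (auto simp: u_def)
    show "x - m \<le> 1" using m by (simp add: u_def)
    show "x * x \<le> x * u" "x * x \<le> 2 * m * x" using m by (auto simp: mult_left_mono)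
  qed (use m in auto)
  finally have upper: "R1 x \<le> 2 / x\<^sup>2" by (simp add: power2_eq_square)
  have "ln (u / x) \<le> u / x - 1" by (rule ln_le_minus_one) (use m in auto)
  with R1 \<theta> have "R1 x \<ge> - (u / x - 1) + (u - x - 1/2) / x + 1 / (2 * u)"
    using m by (simp add: ln_div)
  also have "- (u / x - 1) + (u - x - 1/2) / x + 1 / (2 * u) = - ((u - x) / (2 * x * u))"
    using m by (simp add: field_simps)
  finally have "R1 x \<ge> - ((u - x) / (2 * x * u))" .
  moreover have "(u - x) / (2 * x * u) \<le> 1 / (x * x)"
  proof (rule frac_le)
    show "x * x \<le> 2 * x * u" using m by (auto intro!: mult_mono)
  qed (use m in \<open>auto simp: u_def\<close>)
  ultimately have "R1 x \<ge> - (1 / x\<^sup>2)" by (simp add: power2_eq_square)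
  moreover have "2 / x\<^sup>2 \<le> 3 / x\<^sup>2" "1 / x\<^sup>2 \<le> 3 / x\<^sup>2" by (auto intro: divide_right_mono)
  ultimately show ?thesis using upper by linarith
next
  case False
  then have x: "0 < x" "x < 1" "\<lfloor>x\<rfloor> = 0" using assms by (auto simp: floor_eq_iff)
  have R1: "R1 x = ln x + (euler_mascheroni - 1) + 1 / (2 * x)"
    using x by (simp add: R1_def H_def frac_def field_simps)
  have "ln (1 / x) \<le> 1 / x - 1" by (rule ln_le_minus_one) (use x in auto)
  then have "- ln x \<le> 1 / x" "ln x \<le> 0" using x by (auto simp: ln_div)
  moreover have "euler_mascheroni \<ge> (0::real)" "euler_mascheroni \<le> (1::real)"
    using euler_mascheroni_pos euler_mascheroni_less_13_over_22 by simp_all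
  moreover have "1 \<le> 1 / x" "1 / (2 * x) \<le> 1 / x" using x by (auto simp: field_simps)
  moreover have "1 / x \<le> 1 / x\<^sup>2" using x by (simp add: field_simps power2_eq_square)
  moreover have "1 / (2 * x) > 0" using x by simp
  moreover have "3 / x\<^sup>2 = 3 * (1 / x\<^sup>2)" by simp
  ultimately show ?thesis unfolding R1 by linarith
qed

lemma borel_measurable_R1 [measurable]: "R1 \<in> borel_measurable borel"
proof -
  have [measurable]: "(\<lambda>x. H x) \<in> borel_measurable borel"
    unfolding H_eq_harm by (rule measurable_compose[OF measurable_real_floor]) simp
  have [measurable]: "(\<lambda>x::real. real_of_int \<lfloor>x\<rfloor>) \<in> borel_measurable borel"
    by (rule measurable_compose[OF measurable_real_floor]) simp
  show ?thesis unfolding R1_def [abs_def] frac_def by measurable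
qed

section \<open>Integrals over half-lines and antiderivatives with kinks at the integers\<close>

lemma set_integrable_inverse_square:
  assumes "a > (0::real)"
  shows "set_integrable lborel {a..} (\<lambda>x. 1 / x\<^sup>2)"
proof -
  have "(\<lambda>x. 1 / x\<^sup>2) absolutely_integrable_on {a..}"
    using has_integral_inverse_power_to_inf[of 2 a] assms
    by (intro nonnegative_absolutely_integrable_1) auto
  then show ?thesis
    unfolding set_integrable_def by (subst (asm) integrable_completion) auto
qed

lemma set_integrable_if_bounded_by_inverse_square:
  fixes f :: "real \<Rightarrow> real"
  assumes "a > 0" and [measurable]: "f \<in> borel_measurable borel"
    and "\<And>x. x \<ge> a \<Longrightarrow> \<bar>f x\<bar> \<le> C / x\<^sup>2"
  shows "set_integrable lborel {a..} f"
proof (rule set_integrable_bound)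
  show "set_integrable lborel {a..} (\<lambda>x. C * (1 / x\<^sup>2))"
    by (rule set_integrable_mult_right) (rule set_integrable_inverse_square[OF assms(1)])
  show "AE x in lborel. x \<in> {a..} \<longrightarrow> norm (f x) \<le> norm (C * (1 / x\<^sup>2))"
    using assms(3) by (intro always_eventually allI impI) (use abs_ge_self order_trans in fastforce)
qed (auto simp: set_borel_measurable_def)

lemma finite_Ints_Icc: "finite (\<int> \<inter> {a..b::real})"
proof (rule finite_subset)
  show "\<int> \<inter> {a..b} \<subseteq> of_int ` {\<lfloor>a\<rfloor>..\<lceil>b\<rceil>}"
    by (auto elim!: Ints_cases simp: floor_le_iff le_ceiling_iff intro!: imageI)
qed auto

text \<open>On a compact interval the fundamental theorem tolerates finitely many exceptional
  points, here the integers. Integrability of \<open>f\<close> makes the limit of \<open>F\<close>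
  exist without any prior control of its growth; to identify its value, a single sequence tending to
  infinity is then enough.\<close>

lemma tendsto_antiderivative_at_top:
  fixes F f :: "real \<Rightarrow> real"
  assumes int: "set_integrable lborel {a..} f"
    and cont: "continuous_on {a..} F"
    and deriv: "\<And>x. x > a \<Longrightarrow> x \<notin> \<int> \<Longrightarrow> (F has_real_derivative - f x) (at x)"
  shows "(F \<longlongrightarrow> F a - (LBINT t:{a..}. f t)) at_top"
proof -
  have eq: "F b = F a - (LBINT t:{a..b}. f t)" if "b \<ge> a" for b
  proof -
    have "((\<lambda>x. - f x) has_integral (F b - F a)) {a..b}"
    proof (rule fundamental_theorem_of_calculus_interior_strong[OF finite_Ints_Icc[of a b] that])
      show "(F has_vector_derivative - f x) (at x)" if "x \<in> {a<..<b} - \<int> \<inter> {a..b}" for x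
        using deriv[of x] that by (auto simp: has_real_derivative_iff_has_vector_derivative)
      show "continuous_on {a..b} F" by (rule continuous_on_subset[OF cont]) auto
    qed
    then have "integral {a..b} f = F a - F b"
      by (drule_tac has_integral_neg) (simp add: integral_unique)
    moreover have "set_integrable lborel {a..b} f" by (rule set_integrable_subset[OF int]) auto
    ultimately show ?thesis using set_borel_integral_eq_integral(2) by force
  qed
  have "((\<lambda>y. \<integral>x. indicator {..y} x *\<^sub>R (indicator {a..} x *\<^sub>R f x) \<partial>lborel)
           \<longlongrightarrow> (LBINT t:{a..}. f t)) at_top"
    unfolding set_lebesgue_integral_def
    by (rule tendsto_integral_at_top) (use int in \<open>auto simp: set_integrable_def\<close>)
  moreover have *: "indicator {..y} x *\<^sub>R (indicator {a..} x *\<^sub>R f x) = indicator {a..y} x *\<^sub>R f x" for x y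
    by (auto split: split_indicator)
  ultimately have "((\<lambda>y. LBINT t:{a..y}. f t) \<longlongrightarrow> (LBINT t:{a..}. f t)) at_top"
    unfolding set_lebesgue_integral_def by (simp only: *)
  then have "((\<lambda>y. F a - (LBINT t:{a..y}. f t)) \<longlongrightarrow> F a - (LBINT t:{a..}. f t)) at_top"
    by (intro tendsto_intros)
  moreover have "eventually (\<lambda>y. F a - (LBINT t:{a..y}. f t) = F y) at_top"
    using eventually_ge_at_top[of a] by eventually_elim (rule eq[symmetric])
  ultimately show ?thesis by (rule Lim_transform_eventually)
qed

lemma set_integral_scale:
  fixes f :: "real \<Rightarrow> real"
  assumes "c > 0"
  shows "(LBINT t:{a..}. f (c * t)) = (LBINT u:{c * a..}. f u) / c"
proof -
  have "indicat_real {c * a..} (c * t) = indicat_real {a..} t" for t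
    using assms by (auto split: split_indicator)
  then show ?thesis
    using lborel_integral_real_affine[of c "\<lambda>u. indicat_real {c * a..} u *\<^sub>R f u" 0] assms
    unfolding set_lebesgue_integral_def by (simp add: divide_simps mult_ac)
qed

text \<open>\<open>G n\<close> is a differentiable expression for \<open>F\<close> on the closed
  interval from n to n + 1. Closedness carries the matching: at an integer the two neighbouring
  expressions both take the value \<open>F x\<close>, so the one-sided limits agree. Derivatives are
  claimed only in the open intervals.\<close>

lemma
  fixes F :: "real \<Rightarrow> real"
  assumes F: "\<And>n x. x > 0 \<Longrightarrow> real n \<le> x \<Longrightarrow> x \<le> real n + 1 \<Longrightarrow> F x = G n x"
    and G: "\<And>n x. x > 0 \<Longrightarrow> (G n has_real_derivative g n x) (at x)"
  shows continuous_on_piecewise: "continuous_on {0<..} F"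
    and DERIV_piecewise: "x > 0 \<Longrightarrow> x \<notin> \<int> \<Longrightarrow> (F has_real_derivative g (nat \<lfloor>x\<rfloor>) x) (at x)"
proof -
  show D: "(F has_real_derivative g (nat \<lfloor>x\<rfloor>) x) (at x)" if x: "x > 0" "x \<notin> \<int>" for x
  proof -
    define n where "n = nat \<lfloor>x\<rfloor>"
    have "real n \<noteq> x" using x by auto
    then have n: "real n < x" "x < real n + 1" using x unfolding n_def by linarith+
    show ?thesis
    proof (rule has_field_derivative_transform_within_open)
      show "(G n has_real_derivative g (nat \<lfloor>x\<rfloor>) x) (at x)" unfolding n_def by (rule G) fact
      show "x \<in> {real n<..<real n + 1}" using n by auto
      show "G n y = F y" if "y \<in> {real n<..<real n + 1}" for y
        by (rule F[symmetric]) (use that in auto)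
    qed auto
  qed
  have "isCont F x" if x: "x > 0" for x
  proof (cases "x \<in> \<int>")
    case False
    then show ?thesis using DERIV_isCont[OF D[OF x]] by simp
  next
    case True
    then obtain k where k: "x = of_int k" by (elim Ints_cases)
    \<comment> \<open>Since x > 0 forces k >= 1, nothing is truncated; x is the right end of the
      interval of \<open>G m\<close> and the left end of that of \<open>G (Suc m)\<close>.\<close>
    define m where "m = nat (k - 1)"
    have m: "x = real (Suc m)" using k x by (simp add: m_def)
    have "(F \<longlongrightarrow> F x) (at_left x)"
    proof -
      have "(G m \<longlongrightarrow> G m x) (at_left x)"
        using DERIV_isCont[OF G[OF x]] by (auto simp: isCont_def intro: tendsto_within_subset)
      moreover have "eventually (\<lambda>y. y \<in> {real m<..<x}) (at_left x)"
        using eventually_at_left_real[of "real m" x] m by simp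
      then have "eventually (\<lambda>y. G m y = F y) (at_left x)"
        by eventually_elim (use m in \<open>auto intro!: F[symmetric]\<close>)
      moreover have "F x = G m x" by (rule F) (use m in auto)
      ultimately show ?thesis by (simp add: Lim_transform_eventually)
    qed
    moreover have "(F \<longlongrightarrow> F x) (at_right x)"
    proof -
      have "(G (Suc m) \<longlongrightarrow> G (Suc m) x) (at_right x)"
        using DERIV_isCont[OF G[OF x]] by (auto simp: isCont_def intro: tendsto_within_subset)
      moreover have "eventually (\<lambda>y. y \<in> {x<..<x + 1}) (at_right x)"
        using eventually_at_right_real[of x "x + 1"] by simp
      then have "eventually (\<lambda>y. G (Suc m) y = F y) (at_right x)"
        by eventually_elim (use m in \<open>auto intro!: F[symmetric]\<close>)
      moreover have "F x = G (Suc m) x" by (rule F) (use m in auto)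
      ultimately show ?thesis by (simp add: Lim_transform_eventually)
    qed
    ultimately show ?thesis unfolding isCont_def by (simp add: filterlim_split_at)
  qed
  then show "continuous_on {0<..} F" by (intro continuous_at_imp_continuous_on) auto
qed

section \<open>Stirling's constant and the function \<open>V\<close>\<close>

lemma ln_wallis_product:
  "ln (\<Prod>k=1..n. (4 * real k ^ 2) / (4 * real k ^ 2 - 1))
     = 4 * real n * ln 2 + 4 * ln (fact n) - 2 * ln (fact (2 * n)) - ln (2 * real n + 1)"
proof (induction n)
  case (Suc n)
  define x where "x = real n + 1"
  have x: "x \<ge> 1" "real (Suc n) = x" by (simp_all add: x_def)
  have pos: "(\<Prod>k=1..n. (4 * real k ^ 2) / (4 * real k ^ 2 - 1)) > 0"
  proof (rule prod_pos)
    fix k assume "k \<in> {1..n}"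
    then have "1 \<le> (real k)\<^sup>2" by simp
    then have "0 < 4 * (real k)\<^sup>2" "0 < 4 * (real k)\<^sup>2 - 1" by linarith+
    then show "0 < 4 * (real k)\<^sup>2 / (4 * (real k)\<^sup>2 - 1)" by (rule divide_pos_pos)
  qed
  have fact: "fact (2 * Suc n) = (2 * x) * (2 * x - 1) * (fact (2 * n) :: real)"
    by (simp add: x_def algebra_simps)
  have fact': "fact (Suc n) = x * (fact n :: real)" by (simp add: x_def)
  \<comment> \<open>As 2x - 1 = 2n + 1, this factor joins the one from the induction hypothesis to
    give the square occurring in (2n+2)!^2, while 2x + 1 = 2(n+1) + 1 supplies the new last
    term.\<close>
  have "4 * x ^ 2 - 1 = (2 * x - 1) * (2 * x + 1)" by (simp add: algebra_simps power2_eq_square)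
  then have factor: "ln ((4 * x ^ 2) / (4 * x ^ 2 - 1)) = 2 * ln 2 + 2 * ln x - ln (2 * x - 1) - ln (2 * x + 1)"
    using x by (simp add: ln_div ln_mult ln_realpow ln_realpow[of 2 2, simplified])
  have prod: "ln (\<Prod>k=1..Suc n. (4 * real k ^ 2) / (4 * real k ^ 2 - 1)) =
      ln (\<Prod>k=1..n. (4 * real k ^ 2) / (4 * real k ^ 2 - 1)) + ln ((4 * x ^ 2) / (4 * x ^ 2 - 1))"
  proof -
    have "4 * x ^ 2 - 1 > 0" using one_le_power[OF x(1), of 2] by linarith
    then have "(4 * x ^ 2) / (4 * x ^ 2 - 1) > 0" using x by simp
    with pos have "ln ((\<Prod>k=1..n. (4 * real k ^ 2) / (4 * real k ^ 2 - 1)) * ((4 * x ^ 2) / (4 * x ^ 2 - 1))) =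
      ln (\<Prod>k=1..n. (4 * real k ^ 2) / (4 * real k ^ 2 - 1)) + ln ((4 * x ^ 2) / (4 * x ^ 2 - 1))"
      by (rule ln_mult_pos)
    then show ?thesis by (simp add: x(2) del: of_nat_Suc)
  qed
  have ln_fact: "ln ((2 * x) * (2 * x - 1) * (fact (2 * n))) = ln 2 + ln x + ln (2 * x - 1) + ln (fact (2 * n))"
    "ln (x * fact n) = ln x + ln (fact n)"
    using x by (simp_all add: ln_mult)
  have n: "2 * real n + 1 = 2 * x - 1" "real n = x - 1" by (simp_all add: x_def)
  show ?case
    unfolding prod factor Suc fact fact' x(2) ln_fact n(1) unfolding n(2) by (simp add: algebra_simps)
qed auto

text \<open>Writing D for the sequence, 2 D(n) - D(2n) tends to 2c - c = c. It equals half the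
  logarithm of the Wallis product times 2(2n+1)/n, and these factors tend to pi/2 and 4. Convergence
  is assumed here; it will come from the integrability of \<open>R1\<close>.\<close>

lemma stirling_constant:
  assumes "(\<lambda>n. ln (fact n) - (real n + 1/2) * ln (real n) + real n) \<longlonglongrightarrow> c"
  shows "c = 1/2 * ln (2 * pi)"
proof -
  define D where "D = (\<lambda>n. ln (fact n) - (real n + 1/2) * ln (real n) + real n)"
  define P where "P = (\<lambda>n. \<Prod>k=1..n. (4 * real k ^ 2) / (4 * real k ^ 2 - 1))"
  have "filterlim (\<lambda>n::nat. 2 * n) at_top sequentially"
    by (rule filterlim_subseq) (auto simp: strict_mono_def)
  then have "(\<lambda>n. 2 * D n - D (2 * n)) \<longlonglongrightarrow> 2 * c - c"
    using assms unfolding D_def[symmetric]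
    by (intro tendsto_intros) (auto intro: filterlim_compose[of D])
  moreover have "(\<lambda>n. 1/2 * (ln (P n) + ln (2 * (2 * real n + 1) / real n))) \<longlonglongrightarrow> 1/2 * (ln (pi / 2) + ln 4)"
  proof (intro tendsto_intros)
    show "P \<longlonglongrightarrow> pi / 2" unfolding P_def by (rule wallis)
    show "(\<lambda>n. 2 * (2 * real n + 1) / real n) \<longlonglongrightarrow> 4" by real_asymp
  qed auto
  then have "(\<lambda>n. 2 * D n - D (2 * n)) \<longlonglongrightarrow> 1/2 * (ln (pi / 2) + ln 4)"
  proof (rule Lim_transform_eventually)
    show "eventually (\<lambda>n. 1/2 * (ln (P n) + ln (2 * (2 * real n + 1) / real n)) = 2 * D n - D (2 * n)) sequentially"
    using eventually_gt_at_top[of 0]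
  proof eventually_elim
    case (elim n)
    then have "ln (2 * (2 * real n + 1) / real n) = ln 2 + ln (2 * real n + 1) - ln (real n)"
      by (subst ln_divide_pos, simp, simp, subst ln_mult_pos) simp_all
    moreover have "ln (real (2 * n)) = ln 2 + ln (real n)" using elim by (simp add: ln_mult)
    ultimately show ?case
      unfolding P_def ln_wallis_product D_def by (simp add: algebra_simps)
  qed
  qed
  ultimately have "2 * c - c = 1/2 * (ln (pi / 2) + ln 4)" by (rule LIMSEQ_unique)
  moreover have "ln (pi / 2) + ln 4 = ln (2 * pi)" using ln_mult_pos[of "pi / 2" 4] by simp
  ultimately show ?thesis by simp
qed

text \<open>The right endpoint is included because the jumps cancel there: at x = n + 1 the harmonic
  sum gains x * (1/x) = 1 and the sum of logarithms gains ln x, while the floor term takes away 1 +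
  ln x.\<close>

lemma V_eq:
  assumes "x > 0" "real n \<le> x" "x \<le> real n + 1"
  shows "V x = x * (harm n - ln x - euler_mascheroni + 2) - 1/2 * ln x + (\<Sum>k\<in>{1..n}. ln (real k))
      - real n * (1 + ln x) - 1/2 * ln (2 * pi) - 1/2"
proof (cases "x = real n + 1")
  case True
  then have "nat \<lfloor>x\<rfloor> = Suc n" "\<lfloor>x\<rfloor> = int (Suc n)" by linarith+
  then show ?thesis using True
    by (simp add: V_def H_eq_harm harm_Suc field_simps add_ac)
next
  case False
  then have "nat \<lfloor>x\<rfloor> = n" "\<lfloor>x\<rfloor> = int n" using assms by linarith+
  then show ?thesis by (simp add: V_def H_eq_harm)
qed

lemma
  shows continuous_on_V: "continuous_on {0<..} V"
    and DERIV_V: "x > 0 \<Longrightarrow> x \<notin> \<int> \<Longrightarrow> (V has_real_derivative - R1 x) (at x)"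
proof -
  define G where "G = (\<lambda>n x. x * (harm n - ln x - euler_mascheroni + 2) - 1/2 * ln x
      + (\<Sum>k\<in>{1..n}. ln (real k)) - real n * (1 + ln x) - 1/2 * ln (2 * pi) - 1/2)"
  define g where "g = (\<lambda>n x. harm n - ln x - euler_mascheroni + 1 - 1 / (2 * x) - real n / x)"
  have V: "x > 0 \<Longrightarrow> real n \<le> x \<Longrightarrow> x \<le> real n + 1 \<Longrightarrow> V x = G n x" for n x
    unfolding G_def by (rule V_eq)
  have G: "x > 0 \<Longrightarrow> (G n has_real_derivative g n x) (at x)" for n x
    unfolding G_def g_def
    by (auto intro!: derivative_eq_intros simp: field_simps)
  show "continuous_on {0<..} V" by (rule continuous_on_piecewise[OF V G])
  assume x: "x > 0" "x \<notin> \<int>"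
  have "real (nat \<lfloor>x\<rfloor>) = of_int \<lfloor>x\<rfloor>" using x by simp
  then have "g (nat \<lfloor>x\<rfloor>) x = - R1 x"
    using x unfolding g_def R1_def H_eq_harm frac_def by (simp add: field_simps)
  with DERIV_piecewise[where G = G and g = g, OF V G x] show "(V has_real_derivative - R1 x) (at x)" by simp
qed

lemma R1_of_nat: "n > 0 \<Longrightarrow> R1 (real n) = ln (real n) + euler_mascheroni - harm n + 1 / (2 * real n)"
  by (simp add: R1_def H_eq_harm frac_def)

lemma of_nat_mult_R1_tendsto_0: "(\<lambda>n. real n * R1 (real n)) \<longlonglongrightarrow> 0"
proof (rule Lim_null_comparison)
  show "(\<lambda>n. 3 / real n) \<longlonglongrightarrow> 0" by real_asymp
  show "eventually (\<lambda>n. norm (real n * R1 (real n)) \<le> 3 / real n) sequentially"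
    using eventually_gt_at_top[of 0]
  proof eventually_elim
    case (elim n)
    then have "real n * \<bar>R1 (real n)\<bar> \<le> real n * (3 / (real n)\<^sup>2)"
      by (intro mult_left_mono abs_R1_le) auto
    with elim show ?case by (simp add: abs_mult power2_eq_square)
  qed
qed

lemma set_integrable_R1: "a > 0 \<Longrightarrow> set_integrable lborel {a..} R1"
  by (rule set_integrable_if_bounded_by_inverse_square[where C = 3]) (auto intro: abs_R1_le)

lemma V_tendsto_antiderivative:
  "a > 0 \<Longrightarrow> (V \<longlongrightarrow> V a - (LBINT t:{a..}. R1 t)) at_top"
  by (rule tendsto_antiderivative_at_top)
     (auto intro: set_integrable_R1 DERIV_V continuous_on_subset[OF continuous_on_V])

lemma V_of_nat:
  assumes "n > 0"
  shows "V (real n) = ln (fact n) - (real n + 1/2) * ln (real n) + real n - real n * R1 (real n) - 1/2 * ln (2 * pi)"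
proof -
  have "(\<Sum>k=1..n. ln (real k)) = ln (fact n)"
    by (subst fact_prod, subst of_nat_prod, rule ln_prod[symmetric]) auto
  then show ?thesis using assms
    by (simp add: R1_of_nat V_def H_eq_harm algebra_simps)
qed

text \<open>A limit L of \<open>V\<close> exists since \<open>R1\<close> is integrable. At an
  integer n, \<open>V\<close> is Stirling's expression minus n \<open>R1 n\<close> minus the
  expected constant, and n \<open>R1 n\<close> vanishes in the limit. So Stirling's expression
  converges, as \<open>stirling_constant\<close> requires, and the value found there forces L =
  0.\<close>

lemma V_tendsto_0: "(V \<longlongrightarrow> 0) at_top"
  and stirling: "(\<lambda>n. ln (fact n) - (real n + 1/2) * ln (real n) + real n) \<longlonglongrightarrow> 1/2 * ln (2 * pi)"
proof -
  define L where "L = V 1 - (LBINT t:{1..}. R1 t)"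
  have L: "(V \<longlongrightarrow> L) at_top" unfolding L_def by (rule V_tendsto_antiderivative) simp
  have "(\<lambda>n. V (real n) + real n * R1 (real n) + 1/2 * ln (2 * pi)) \<longlonglongrightarrow> L + 0 + 1/2 * ln (2 * pi)"
    by (intro tendsto_add of_nat_mult_R1_tendsto_0 tendsto_const
        filterlim_compose[OF L filterlim_real_sequentially])
  moreover have "eventually (\<lambda>n. V (real n) + real n * R1 (real n) + 1/2 * ln (2 * pi) =
      ln (fact n) - (real n + 1/2) * ln (real n) + real n) sequentially"
    using eventually_gt_at_top[of 0] by eventually_elim (simp add: V_of_nat)
  ultimately have D: "(\<lambda>n. ln (fact n) - (real n + 1/2) * ln (real n) + real n) \<longlonglongrightarrow> L + 0 + 1/2 * ln (2 * pi)"
    by (rule Lim_transform_eventually)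
  from stirling_constant[OF this] have "L = 0" by simp
  with L D show "(V \<longlongrightarrow> 0) at_top"
    "(\<lambda>n. ln (fact n) - (real n + 1/2) * ln (real n) + real n) \<longlonglongrightarrow> 1/2 * ln (2 * pi)"
    by simp_all
qed

lemma V_eq_integral: "x > 0 \<Longrightarrow> V x = (LBINT t:{x..}. R1 t)"
  using tendsto_unique[OF _ V_tendsto_antiderivative V_tendsto_0] by fastforce

section \<open>The first Stieltjes constant as a limit of logarithmic sums\<close>

lemma zeta_aux_uniform_limit:
  "uniform_limit (ball 1 (1/2)) (\<lambda>N s. \<Sum>n<N. zeta_aux n s) (\<lambda>s. \<Sum>n. zeta_aux n s) sequentially"
proof (rule Weierstrass_m_test)
  \<comment> \<open>On this disc Re s > 1/2, whence the exponent -1/2 - 1, and |s - 1| |s| <= (1/2)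
    * 2, whence the factor 1.\<close>
  show "norm (zeta_aux n s) \<le> 1 * real (Suc n) powr (- 3/2)" if "s \<in> ball 1 (1/2)" for n s
  proof -
    have s: "norm (s - 1) < 1/2" using that by (simp add: dist_norm norm_minus_commute)
    then have "\<bar>Re (s - 1)\<bar> < 1/2" using abs_Re_le_cmod[of "s - 1"] by linarith
    then have re: "Re s > 1/2" by (simp add: abs_if split: if_splits)
    have "norm s \<le> 2" using s norm_triangle_ineq[of "s - 1" 1] by simp
    then have "norm (s - 1) * norm s \<le> 1/2 * 2" using s by (intro mult_mono) auto
    moreover have "real (Suc n) powr (- Re s - 1) \<le> real (Suc n) powr (- 3/2)"
      using re by (intro powr_mono) auto
    ultimately have "norm (s - 1) * norm s * real (Suc n) powr (- Re s - 1) \<le> 1 * real (Suc n) powr (- 3/2)"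
      by (intro mult_mono) auto
    with norm_zeta_aux_le[of s n] re show ?thesis by linarith
  qed
  have "summable (\<lambda>n. real (Suc n) powr (- 3/2))"
    by (subst summable_Suc_iff[where f = "\<lambda>n. real n powr (- 3/2)"]) (simp add: summable_real_powr_iff)
  then show "summable (\<lambda>n. 1 * real (Suc n) powr (- 3/2))" by simp
qed

text \<open>These are the second derivatives of the terms \<open>zeta_aux n\<close> at 1, where the
  powers with exponent 1 - s become 1. On summation the squared logarithms telescope and the terms
  -2 ln k / k remain.\<close>

lemma zeta_aux_deriv_has_deriv_1:
  "(zeta_aux_deriv n has_field_derivative
      of_real ((ln (real (n + 2)))\<^sup>2 - (ln (real (Suc n)))\<^sup>2 - 2 * ln (real (Suc n)) / real (Suc n))) (at 1)"
proof -
  define a b :: complex where "a = of_nat (Suc n)" and "b = of_nat (n + 2)"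
  have ab: "a \<noteq> 0" "b \<noteq> 0" unfolding a_def b_def of_nat_eq_0_iff by simp_all
  have Ln: "Ln a = of_real (ln (real (Suc n)))" "Ln b = of_real (ln (real (n + 2)))"
    using Ln_of_real[of "real (Suc n)"] Ln_of_real[of "real (n + 2)"]
    by (simp_all add: a_def b_def del: of_nat_Suc of_nat_add)
  have powr: "((\<lambda>z. c powr f z) has_field_derivative c powr f s * Ln c * f') (at s)"
    if "c \<noteq> 0" "(f has_field_derivative f') (at s)" for c f f' s
    using DERIV_chain2[OF has_field_derivative_powr_right[OF that(1)] that(2)]
    by (simp add: mult_ac)
  have "((\<lambda>s. a powr (-s) - (s - 1) * a powr (-s) * Ln a - b powr (1 - s) * Ln b + a powr (1 - s) * Ln a)
      has_field_derivative ((Ln b)\<^sup>2 - (Ln a)\<^sup>2 - 2 * Ln a / a)) (at 1)"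
    by (rule derivative_eq_intros powr ab refl)+
       (use ab in \<open>simp add: powr_minus_divide power2_eq_square field_simps\<close>)
  then show ?thesis
    unfolding zeta_aux_deriv_def [abs_def] a_def[symmetric] b_def[symmetric] Ln
    by (simp add: a_def)
qed

text \<open>
  Here \<open>g(s) = (s - 1) \<zeta>(s) - 1\<close>. Cauchy's inequality on shrinking circles shows that the remainder
  \<open>h(s) = O((s - 1)\<^sup>3)\<close> has vanishing second derivative at \<open>1\<close>.
\<close>

lemma second_Taylor_coefficient_zeta:
  assumes g: "\<And>s. Re s > 0 \<Longrightarrow> (\<lambda>n. zeta_aux n s) sums g s"
    "\<And>s. Re s > 0 \<Longrightarrow> (g has_field_derivative g' s) (at s)"
  shows "(deriv ^^ 2) g 1 = of_real (- 2 * stieltjes_gamma1)"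
proof -
  define S where "S = {s::complex. Re s > 0}"
  have S: "open S" "1 \<in> S" by (auto simp: S_def open_halfspace_Re_gt)
  have hol: "g holomorphic_on S" unfolding S_def
    by (rule holomorphic_onI)
      (use g(2) in \<open>auto simp: field_differentiable_def intro: has_field_derivative_at_within\<close>)
  \<comment> \<open>Subtracted is the quadratic Taylor polynomial that \<open>zeta_expansion\<close>
    predicts for \<open>g\<close>; its constant term is 0 because the pole has residue 1.\<close>
  define h where "h = (\<lambda>s. g s - of_real euler_mascheroni * (s - 1) + of_real stieltjes_gamma1 * (s - 1)\<^sup>2)"
  have hol_h: "h holomorphic_on S" unfolding h_def by (intro holomorphic_intros hol)
  define z where "z = (\<lambda>s. zeta s - (1 / (s - 1) + of_real euler_mascheroni - of_real stieltjes_gamma1 * (s - 1)))"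
  have ev: "eventually (\<lambda>s. s \<in> S - {1}) (at 1)"
    using S eventually_at_topological[of "\<lambda>s. s \<in> S - {1}" 1 UNIV] by auto
  have "(\<lambda>s. (s - 1) * z s) \<in> O[at 1](\<lambda>s. (s - 1) * (s - 1)\<^sup>2)"
    unfolding z_def by (intro landau_o.big.mult zeta_expansion) auto
  moreover have "eventually (\<lambda>s. (s - 1) * z s = h s) (at 1)"
    using ev
  proof eventually_elim
    case (elim s)
    then have "s \<in> zeta_domain" "s \<noteq> 1" by (auto simp: zeta_domain_def S_def)
    then have "(s - 1) * zeta s = 1 + g s" "(s - 1) * (1 / (s - 1)) = 1"
      using zeta_eq[OF g] by simp_all
    moreover have "(s - 1) * (Z - (p + a - b * (s - 1))) = (s - 1) * Z - (s - 1) * p - a * (s - 1) + b * (s - 1)\<^sup>2"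
      for Z p a b by (simp add: algebra_simps power2_eq_square)
    ultimately show ?case
      unfolding z_def h_def by simp
  qed
  ultimately have bigo: "h \<in> O[at 1](\<lambda>s. (s - 1) ^ 3)"
    by (simp add: landau_o.big.in_cong power3_eq_cube power2_eq_square mult.assoc)
  then obtain K where K: "K > 0" "eventually (\<lambda>s. norm (h s) \<le> K * norm ((s - 1) ^ 3)) (at 1)"
    by (elim landau_o.bigE)
  then obtain d where d: "d > 0" "\<And>s::complex. s \<noteq> 1 \<Longrightarrow> dist s 1 < d \<Longrightarrow> norm (h s) \<le> K * norm ((s - 1) ^ 3)"
    unfolding eventually_at by auto
  \<comment> \<open>The cap 1 keeps closed discs of radius below \<open>e\<close> inside Re s > 0,
    where \<open>h\<close> is holomorphic.\<close>
  define e where "e = min d 1"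
  have e: "e > 0" "e \<le> d" "e \<le> 1" using d by (auto simp: e_def)
  have cball: "cball 1 \<rho> \<subseteq> S" if "\<rho> < e" for \<rho>
  proof
    fix s :: complex assume "s \<in> cball 1 \<rho>"
    then have "norm (s - 1) < 1" using that e by (auto simp: dist_norm norm_minus_commute)
    then have "\<bar>Re (s - 1)\<bar> < 1" using abs_Re_le_cmod[of "s - 1"] by linarith
    then show "s \<in> S" by (simp add: S_def abs_if split: if_splits)
  qed
  have bound: "norm ((deriv ^^ 2) h 1) \<le> 2 * K * \<rho>" if "\<rho> > 0" "\<rho> < e" for \<rho>
  proof -
    have "norm ((deriv ^^ 2) h 1) \<le> fact 2 * (K * \<rho> ^ 3) / \<rho> ^ 2"
    proof (rule Cauchy_inequality)
      show "h holomorphic_on ball 1 \<rho>" "continuous_on (cball 1 \<rho>) h"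
        using cball[OF that(2)] ball_subset_cball hol_h
        by (meson holomorphic_on_imp_continuous_on holomorphic_on_subset subset_trans)+
      show "norm (h s) \<le> K * \<rho> ^ 3" if "norm (1 - s) = \<rho>" for s
        using d(2)[of s] that e \<open>\<rho> > 0\<close> \<open>\<rho> < e\<close>
        by (auto simp: norm_power norm_minus_commute dist_norm)
    qed fact
    also have "\<dots> = 2 * K * \<rho>" using that by (simp add: power2_eq_square power3_eq_cube)
    finally show ?thesis .
  qed
  have "norm ((deriv ^^ 2) h 1) \<le> 0"
  proof (rule tendsto_lowerbound)
    show "((\<lambda>\<rho>. 2 * K * \<rho>) \<longlongrightarrow> 0) (at_right 0)"
      by (intro tendsto_mult_right_zero tendsto_ident_at)
    show "eventually (\<lambda>\<rho>. norm ((deriv ^^ 2) h 1) \<le> 2 * K * \<rho>) (at_right 0)"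
      using eventually_at_right_real[OF e(1)] by eventually_elim (use bound in auto)
  qed simp
  then have h0: "(deriv ^^ 2) h 1 = 0" by simp
  have deriv_h: "deriv h s = deriv g s - of_real euler_mascheroni + of_real stieltjes_gamma1 * (2 * (s - 1))"
    if "s \<in> S" for s
    unfolding h_def
    by (rule DERIV_imp_deriv)
       (auto intro!: derivative_eq_intros holomorphic_derivI[OF hol S(1) that] simp: power2_eq_square)
  have "(deriv h has_field_derivative (deriv ^^ 2) g 1 + 2 * of_real stieltjes_gamma1) (at 1)"
  proof (rule has_field_derivative_transform_within_open[OF _ S])
    show "((\<lambda>s. deriv g s - of_real euler_mascheroni + of_real stieltjes_gamma1 * (2 * (s - 1)))
       has_field_derivative (deriv ^^ 2) g 1 + 2 * of_real stieltjes_gamma1) (at 1)"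
      using has_field_derivative_higher_deriv[OF hol S, of 1]
      by (auto intro!: derivative_eq_intros simp: numeral_2_eq_2)
  qed (simp add: deriv_h)
  from DERIV_imp_deriv[OF this] have "(deriv ^^ 2) h 1 = (deriv ^^ 2) g 1 + 2 * of_real stieltjes_gamma1"
    by (simp add: numeral_2_eq_2)
  with h0 show ?thesis by (simp add: eq_neg_iff_add_eq_0)
qed

text \<open>Uniform convergence near 1 lets the series for (s - 1) zeta(s) - 1 be differentiated
  twice term by term. At s = 1 its second derivative is -2 times the constant, and the partial sums
  are computed by telescoping.\<close>

lemma stieltjes_gamma1_LIMSEQ:
  "(\<lambda>n. (\<Sum>k=1..n. ln (real k) / real k) - (ln (real n))\<^sup>2 / 2) \<longlonglongrightarrow> stieltjes_gamma1"
proof -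
  obtain g g' where g: "\<And>s. Re s > 0 \<Longrightarrow> (\<lambda>n. zeta_aux n s) sums g s"
    "\<And>s. Re s > 0 \<Longrightarrow> (g has_field_derivative g' s) (at s)"
    using zeta_aux_suminf by metis
  define B where "B = ball (1::complex) (1/2)"
  define c where "c = (\<lambda>n. (ln (real (n + 2)))\<^sup>2 - (ln (real (Suc n)))\<^sup>2 - 2 * ln (real (Suc n)) / real (Suc n))"
  have B: "open B" "1 \<in> B" by (simp_all add: B_def)
  have Re_B: "Re s > 0" if "s \<in> B" for s
  proof -
    have "norm (s - 1) < 1/2" using that by (simp add: B_def dist_norm norm_minus_commute)
    then have "\<bar>Re (s - 1)\<bar> < 1/2" using abs_Re_le_cmod[of "s - 1"] by linarith
    then show ?thesis by (simp add: abs_if split: if_splits)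
  qed
  have "uniform_limit B (\<lambda>N s. \<Sum>n<N. zeta_aux n s) g sequentially"
    using zeta_aux_uniform_limit unfolding B_def[symmetric]
    by (rule uniform_limit_cong'[THEN iffD1, rotated 2]) (auto intro: sums_unique[symmetric] g Re_B)
  moreover have "(\<lambda>s. \<Sum>n<N. zeta_aux n s) holomorphic_on B" for N
    by (intro holomorphic_intros holomorphic_onI)
       (meson zeta_aux_has_deriv field_differentiable_def field_differentiable_at_within)
  ultimately have "(\<lambda>N. (deriv ^^ 2) (\<lambda>s. \<Sum>n<N. zeta_aux n s) 1) \<longlonglongrightarrow> (deriv ^^ 2) g 1"
    by (intro higher_deriv_complex_uniform_limit[OF _ _ _ B]) auto
  moreover have "(deriv ^^ 2) (\<lambda>s. \<Sum>n<N. zeta_aux n s) 1 = of_real (\<Sum>n<N. c n)" for N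
  proof -
    have "deriv (\<lambda>s. \<Sum>n<N. zeta_aux n s) = (\<lambda>s. \<Sum>n<N. zeta_aux_deriv n s)"
      by (intro ext DERIV_imp_deriv DERIV_sum zeta_aux_has_deriv)
    moreover have "deriv (\<lambda>s. \<Sum>n<N. zeta_aux_deriv n s) 1 = (\<Sum>n<N. of_real (c n))"
      unfolding c_def by (intro DERIV_imp_deriv DERIV_sum zeta_aux_deriv_has_deriv_1)
    ultimately show ?thesis by (simp add: numeral_2_eq_2)
  qed
  ultimately have "(\<lambda>N. complex_of_real (\<Sum>n<N. c n)) \<longlonglongrightarrow> of_real (- 2 * stieltjes_gamma1)"
    using second_Taylor_coefficient_zeta[OF g] by (simp only:)
  then have lim: "(\<lambda>N. \<Sum>n<N. c n) \<longlonglongrightarrow> - 2 * stieltjes_gamma1"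
    by (simp only: tendsto_of_real_iff)
  have sum_c: "(\<Sum>n<N. c n) = (ln (real (N + 1)))\<^sup>2 - 2 * (\<Sum>k=1..N. ln (real k) / real k)" for N
    by (induction N) (simp_all add: c_def algebra_simps)
  \<comment> \<open>The telescoped sum contains the logarithm of N + 1; the added null sequence
    replaces it by that of N.\<close>
  have "(\<lambda>N. - 1/2 * (\<Sum>n<N. c n) + ((ln (real (N + 1)))\<^sup>2 - (ln (real N))\<^sup>2) / 2)
          \<longlonglongrightarrow> - 1/2 * (- 2 * stieltjes_gamma1) + 0"
    by (intro tendsto_add tendsto_mult tendsto_const lim) real_asymp
  then show ?thesis by (simp add: sum_c algebra_simps diff_divide_distrib)
qed

section \<open>The function \<open>R2\<close> as a weighted integral of \<open>R1\<close>\<close>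

lemma R2_eq:
  assumes "x > 0" "real n \<le> x" "x \<le> real n + 1"
  shows "R2 x = 1/x * (1/2 * ln (2 * pi) + 1 + 1/2 * ln x + real n * ln x
        - (\<Sum>k\<in>{1..n}. ln (real k)) + 2 * real n)
      + (2 - euler_mascheroni) * ln x - 1/2 * (ln x)\<^sup>2 + 2 * euler_mascheroni + stieltjes_gamma1 - 3
      + harm n * ln x - (\<Sum>k\<in>{1..n}. ln (real k) / real k) - 2 * harm n"
proof -
  \<comment> \<open>Decoupling the number of summands from x allows an expansion by induction on m
    with x fixed.\<close>
  define T where "T = (\<lambda>m. \<Sum>k\<in>{1..m}. (1 + x / real k) * ln (x / real k) + 2 * (1 - x / real k))"
  have T: "T m = real m * ln x - (\<Sum>k\<in>{1..m}. ln (real k)) + 2 * real m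
      + x * (harm m * ln x - (\<Sum>k\<in>{1..m}. ln (real k) / real k) - 2 * harm m)" for m
  proof (induction m)
    case 0
    then show ?case by (simp add: T_def harm_def)
  next
    case (Suc m)
    define y where "y = real (Suc m)"
    have y: "y > 0" by (simp add: y_def)
    have T_Suc: "T (Suc m) = T m + ((1 + x / y) * (ln x - ln y) + 2 * (1 - x / y))"
      using assms(1) y by (simp add: T_def ln_div y_def del: of_nat_Suc)
    have sums: "(\<Sum>k=1..Suc m. ln (real k)) = (\<Sum>k=1..m. ln (real k)) + ln y"
      "(\<Sum>k=1..Suc m. ln (real k) / real k) = (\<Sum>k=1..m. ln (real k) / real k) + ln y / y"
      "harm (Suc m) = harm m + 1 / y" "real (Suc m) = real m + 1"
      by (simp_all add: y_def harm_Suc inverse_eq_divide)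
    show ?case unfolding T_Suc Suc sums by (simp add: algebra_simps)
  qed
  \<comment> \<open>At x = n + 1 the additional summand has index x and equals 2 ln 1 + 2(1 - 1) =
    0, so the expression for n remains valid at the right endpoint.\<close>
  have T_floor: "T (nat \<lfloor>x\<rfloor>) = T n"
  proof (cases "x = real n + 1")
    case True
    then have "nat \<lfloor>x\<rfloor> = Suc n" "x = real (Suc n)" by linarith+
    then show ?thesis by (simp add: T_def del: of_nat_Suc)
  next
    case False
    then have "nat \<lfloor>x\<rfloor> = n" using assms by linarith
    then show ?thesis by simp
  qed
  define u where "u = 1 / x"
  have uT: "u * T n = u * (real n * ln x - (\<Sum>k\<in>{1..n}. ln (real k)) + 2 * real n)
      + (harm n * ln x - (\<Sum>k\<in>{1..n}. ln (real k) / real k) - 2 * harm n)"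
    unfolding T using assms(1) by (subst distrib_left) (simp add: u_def)
  have "R2 x = u * (1/2 * ln (2 * pi) + 1 + 1/2 * ln x) + (2 - euler_mascheroni) * ln x - 1/2 * (ln x)\<^sup>2
      + 2 * euler_mascheroni + stieltjes_gamma1 - 3 + u * T (nat \<lfloor>x\<rfloor>)"
    unfolding R2_def T_def u_def ..
  then show ?thesis
    unfolding T_floor uT u_def[symmetric] by (simp add: algebra_simps)
qed

lemma
  shows continuous_on_R2: "continuous_on {0<..} R2"
    and DERIV_R2: "x > 0 \<Longrightarrow> x \<notin> \<int> \<Longrightarrow> (R2 has_real_derivative V x / x\<^sup>2) (at x)"
proof -
  define G where "G = (\<lambda>n x. 1/x * (1/2 * ln (2 * pi) + 1 + 1/2 * ln x + real n * ln x
        - (\<Sum>k\<in>{1..n}. ln (real k)) + 2 * real n)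
      + (2 - euler_mascheroni) * ln x - 1/2 * (ln x)\<^sup>2 + 2 * euler_mascheroni + stieltjes_gamma1 - 3
      + harm n * ln x - (\<Sum>k\<in>{1..n}. ln (real k) / real k) - 2 * harm n)"
  define g where "g = (\<lambda>n x. (x * (harm n - ln x - euler_mascheroni + 2) - 1/2 * ln x + (\<Sum>k\<in>{1..n}. ln (real k))
      - real n * (1 + ln x) - 1/2 * ln (2 * pi) - 1/2) / x\<^sup>2)"
  have R2: "x > 0 \<Longrightarrow> real n \<le> x \<Longrightarrow> x \<le> real n + 1 \<Longrightarrow> R2 x = G n x" for n x
    unfolding G_def by (rule R2_eq)
  have G: "x > 0 \<Longrightarrow> (G n has_real_derivative g n x) (at x)" for n x
    unfolding G_def g_def
    by (auto intro!: derivative_eq_intros simp: field_simps power2_eq_square)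
  show "continuous_on {0<..} R2" by (rule continuous_on_piecewise[OF R2 G])
  assume x: "x > 0" "x \<notin> \<int>"
  have "g (nat \<lfloor>x\<rfloor>) x = V x / x\<^sup>2"
    unfolding g_def by (subst V_eq[of x "nat \<lfloor>x\<rfloor>"]) (use x in linarith)+
  with DERIV_piecewise[where G = G and g = g, OF R2 G x] show "(R2 has_real_derivative V x / x\<^sup>2) (at x)" by simp
qed

text \<open>At integers \<open>R2\<close> is a combination of three convergent sequences: Stirling's
  expression \<open>D\<close>, the sequence \<open>Q\<close> defining the Stieltjes constant, and n
  \<open>R1 n\<close>. All growing terms cancel, \<open>Q\<close> cancels against
  \<open>stieltjes_gamma1\<close>, and the rest carries a factor 1/n or ln n / n.\<close>

lemma R2_of_nat_tendsto_0: "(\<lambda>n. R2 (real n)) \<longlonglongrightarrow> 0"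
proof -
  define D where "D = (\<lambda>n. ln (fact n) - (real n + 1/2) * ln (real n) + real n)"
  define Q where "Q = (\<lambda>n. (\<Sum>k=1..n. ln (real k) / real k) - (ln (real n))\<^sup>2 / 2)"
  define \<rho> where "\<rho> = (\<lambda>n. real n * R1 (real n))"
  define c where "c = 1/2 * ln (2 * pi) + 1"
  have D: "D \<longlonglongrightarrow> 1/2 * ln (2 * pi)" unfolding D_def by (rule stirling)
  have Q: "Q \<longlonglongrightarrow> stieltjes_gamma1" unfolding Q_def by (rule stieltjes_gamma1_LIMSEQ)
  have \<rho>: "\<rho> \<longlonglongrightarrow> 0" unfolding \<rho>_def by (rule of_nat_mult_R1_tendsto_0)
  have "(\<lambda>n. c * (1 / real n) - D n * (1 / real n) + stieltjes_gamma1 - Q n + ln (real n) / (2 * real n) - 1 / real n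
      - (ln (real n) / real n) * \<rho> n + 2 * ((1 / real n) * \<rho> n))
     \<longlonglongrightarrow> c * 0 - 1/2 * ln (2 * pi) * 0 + stieltjes_gamma1 - stieltjes_gamma1 + 0 - 0 - 0 * 0 + 2 * (0 * 0)"
    by (intro tendsto_intros D Q \<rho>) real_asymp+
  moreover have "eventually (\<lambda>n. c * (1 / real n) - D n * (1 / real n) + stieltjes_gamma1 - Q n
      + ln (real n) / (2 * real n) - 1 / real n
      - (ln (real n) / real n) * \<rho> n + 2 * ((1 / real n) * \<rho> n) = R2 (real n)) sequentially"
    using eventually_gt_at_top[of 0]
  proof eventually_elim
    case (elim n)
    have fact: "(\<Sum>k=1..n. ln (real k)) = ln (fact n)"
      by (subst fact_prod, subst of_nat_prod, rule ln_prod[symmetric]) auto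
    have harm: "harm n = ln (real n) + euler_mascheroni + 1 / (2 * real n) - R1 (real n)"
      using R1_of_nat[OF elim] by simp
    have "R2 (real n) = 1/real n * (1/2 * ln (2 * pi) + 1 + 1/2 * ln (real n) + real n * ln (real n) - ln (fact n) + 2 * real n)
      + (2 - euler_mascheroni) * ln (real n) - 1/2 * (ln (real n))\<^sup>2 + 2 * euler_mascheroni + stieltjes_gamma1 - 3
      + harm n * ln (real n) - (\<Sum>k\<in>{1..n}. ln (real k) / real k) - 2 * harm n"
      using R2_eq[of "real n" n] elim unfolding fact by simp
    \<comment> \<open>Pure field algebra once the transcendental quantities are variables: N is n, F
      is ln n!, L is ln n, p is ln (2 pi), q is the sum of ln k / k, R is \<open>R1 n\<close>, and e
      and s are the two constants.\<close>
    moreover have "(1/2 * p + 1) * (1 / N) - (F - (N + 1/2) * L + N) * (1 / N) + s - (q - L\<^sup>2 / 2)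
        + L / (2 * N) - 1 / N - (L / N) * (N * R) + 2 * ((1 / N) * (N * R))
      = 1 / N * (1/2 * p + 1 + 1/2 * L + N * L - F + 2 * N) + (2 - e) * L - 1/2 * L\<^sup>2 + 2 * e + s - 3
        + (L + e + 1 / (2 * N) - R) * L - q - 2 * (L + e + 1 / (2 * N) - R)"
      if "N > 0" for p N F L s q R e :: real
      using that by (simp add: field_simps power2_eq_square)
    ultimately show ?case using elim
      unfolding harm D_def Q_def \<rho>_def c_def by (simp only: of_nat_0_less_iff)
  qed
  ultimately show ?thesis by (simp add: Lim_transform_eventually)
qed

lemma
  assumes x: "x > 0"
  shows set_integrable_R1_weighted: "set_integrable lborel {x..} (\<lambda>t. R1 t * (1 / t - 1 / x))"
    and R2_eq_integral: "R2 x = (LBINT t:{x..}. R1 t * (1 / t - 1 / x))"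
proof -
  show int: "set_integrable lborel {x..} (\<lambda>t. R1 t * (1 / t - 1 / x))"
  proof (rule set_integrable_if_bounded_by_inverse_square[OF x])
    fix t assume t: "t \<ge> x"
    have "\<bar>1 / t - 1 / x\<bar> \<le> 1 / x"
      using t x by (simp add: abs_if field_simps)
    then have "\<bar>R1 t\<bar> * \<bar>1 / t - 1 / x\<bar> \<le> 3 / t\<^sup>2 * (1 / x)"
      using t x by (intro mult_mono abs_R1_le) auto
    then show "\<bar>R1 t * (1 / t - 1 / x)\<bar> \<le> (3 / x) / t\<^sup>2" by (simp add: abs_mult mult_ac)
  qed measurable
  \<comment> \<open>Integration by parts read backwards: from the derivatives of \<open>R2\<close>
    and \<open>V\<close>, the terms V/t^2 cancel in the derivative of \<open>F\<close>. At t = x the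
    last two summands cancel, so \<open>F x\<close> is \<open>R2 x\<close>.\<close>
  define F where "F = (\<lambda>t. R2 t + V t / t - V t / x)"
  have "(F \<longlongrightarrow> F x - (LBINT t:{x..}. R1 t * (1 / t - 1 / x))) at_top"
  proof (rule tendsto_antiderivative_at_top[OF int])
    show "continuous_on {x..} F" unfolding F_def using x
      by (auto intro!: continuous_intros continuous_on_subset[OF continuous_on_R2] continuous_on_subset[OF continuous_on_V])
    show "(F has_real_derivative - (R1 t * (1 / t - 1 / x))) (at t)" if "t > x" "t \<notin> \<int>" for t
      unfolding F_def using that x
      by (auto intro!: derivative_eq_intros DERIV_R2 DERIV_V simp: field_simps power2_eq_square)
  qed
  \<comment> \<open>The limit over the reals is already known to exist, so the integers suffice to
    show that it is 0.\<close>
  from filterlim_compose[OF this filterlim_real_sequentially]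
  have "(\<lambda>n. F (real n)) \<longlonglongrightarrow> F x - (LBINT t:{x..}. R1 t * (1 / t - 1 / x))" .
  moreover have "(\<lambda>n. R2 (real n) + V (real n) * (1 / real n) - V (real n) * (1 / x)) \<longlonglongrightarrow> 0 + 0 * 0 - 0 * (1 / x)"
    by (intro tendsto_intros R2_of_nat_tendsto_0 filterlim_compose[OF V_tendsto_0 filterlim_real_sequentially]
        lim_1_over_n)
  then have "(\<lambda>n. F (real n)) \<longlonglongrightarrow> 0" by (simp add: F_def)
  ultimately have "F x = (LBINT t:{x..}. R1 t * (1 / t - 1 / x))"
    using LIMSEQ_unique by fastforce
  then show "R2 x = (LBINT t:{x..}. R1 t * (1 / t - 1 / x))" using x by (simp add: F_def)
qed

section \<open>Interchange of the sum over k with the integral\<close>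

lemma
  fixes w :: "real \<Rightarrow> real"
  assumes r: "r > 0" and [measurable]: "w \<in> borel_measurable borel"
    and w: "\<And>t. t \<ge> r \<Longrightarrow> \<bar>w t\<bar> \<le> B"
  shows set_integrable_S1: "set_integrable lborel {r..} (\<lambda>t. S1 t * w t)"
    and sums_integral_S1:
      "(\<lambda>k. LBINT t:{r..}. R1 (real (Suc k) * t) * w t) sums (LBINT t:{r..}. S1 t * w t)"
proof -
  define f where "f = (\<lambda>k t. indicator {r..} t *\<^sub>R (R1 (real (Suc k) * t) * w t))"
  \<comment> \<open>Domination: \<open>abs_R1_le\<close> at (k+1) t gives 3 / ((k+1)^2 t^2), so the
    k-th term is at most \<open>d t\<close> / (k+1)^2, a product of a function integrable in t and a
    sequence summable in k.\<close>
  define d where "d = (\<lambda>t. indicator {r..} t *\<^sub>R (3 * B / t\<^sup>2))"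
  have B: "B \<ge> 0" using w[of r] by simp
  have R1: "\<bar>R1 (real (Suc k) * t)\<bar> \<le> 3 / t\<^sup>2 * (1 / real (Suc k) ^ 2)" if "t > 0" for k t
    using abs_R1_le[of "real (Suc k) * t"] that by (simp add: power_mult_distrib mult_ac del: of_nat_Suc)
  have bound: "norm (f k t) \<le> 1 / real (Suc k) ^ 2 * d t" for k t
  proof (cases "t \<ge> r")
    case True
    then have "\<bar>R1 (real (Suc k) * t)\<bar> * \<bar>w t\<bar> \<le> (3 / t\<^sup>2 * (1 / real (Suc k) ^ 2)) * B"
      using r by (intro mult_mono R1 w) auto
    then show ?thesis using True by (simp add: f_def d_def abs_mult mult_ac)
  qed (simp add: f_def d_def)
  have sq: "summable (\<lambda>k. 1 / real (Suc k) ^ 2)"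
    using inverse_squares_sums by (simp add: sums_iff)
  have d: "integrable lborel d"
    using set_integrable_mult_right[OF set_integrable_inverse_square[OF r], of "3 * B"]
    by (simp add: d_def set_integrable_def)
  have [measurable]: "f k \<in> borel_measurable borel" for k unfolding f_def by measurable
  have f: "integrable lborel (f k)" for k
  proof (rule Bochner_Integration.integrable_bound)
    show "integrable lborel (\<lambda>t. 1 / real (Suc k) ^ 2 * d t)" by (rule integrable_mult_right) (rule d)
    show "AE t in lborel. norm (f k t) \<le> norm (1 / real (Suc k) ^ 2 * d t)"
      using order_trans[OF bound abs_ge_self] by (intro always_eventually) simp
  qed measurable
  have sf: "summable (\<lambda>k. norm (f k t))" for t
    by (rule summable_comparison_test[OF _ summable_mult2[OF sq, of "d t"]]) (use bound in auto)
  have "summable (\<lambda>k. LBINT t. norm (f k t))"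
  proof (rule summable_comparison_test[OF _ summable_mult2[OF sq, of "integral\<^sup>L lborel d"]], intro exI allI impI)
    fix k
    have "(LBINT t. norm (f k t)) \<le> (LBINT t. 1 / real (Suc k) ^ 2 * d t)"
      by (intro integral_mono integrable_norm f integrable_mult_right d bound)
    then show "norm (LBINT t. norm (f k t)) \<le> 1 / real (Suc k) ^ 2 * integral\<^sup>L lborel d" by simp
  qed
  note * = integrable_suminf[OF f always_eventually[OF allI[OF sf]] this]
    sums_integral[OF f always_eventually[OF allI[OF sf]] this]
  have "(\<Sum>k. f k t) = indicator {r..} t *\<^sub>R (S1 t * w t)" for t
  proof (cases "t \<ge> r")
    case True
    \<comment> \<open>Pointwise convergence justifies moving the factor \<open>w t\<close> out of
      the infinite sum that defines \<open>S1 t\<close>.\<close>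
    have "summable (\<lambda>k. R1 (real (Suc k) * t))"
      by (rule summable_comparison_test[OF _ summable_mult[OF sq, of "3 / t\<^sup>2"]]) (use R1 True r in auto)
    then show ?thesis using True by (simp add: f_def S1_def suminf_mult2)
  qed (simp add: f_def)
  then show "set_integrable lborel {r..} (\<lambda>t. S1 t * w t)"
    "(\<lambda>k. LBINT t:{r..}. R1 (real (Suc k) * t) * w t) sums (LBINT t:{r..}. S1 t * w t)"
    using * unfolding set_integrable_def set_lebesgue_integral_def f_def by simp_all
qed

text \<open>Both identities are instances of \<open>sums_integral_S1\<close>, with weights 1/t - 1/r
  and 1. Integrability is asserted as well, since the integral of a non-integrable function is 0 by
  convention.\<close>

theorem proposition5p2:
  fixes r :: real
  assumes "r > 0"
  shows "set_integrable lborel {r..} (\<lambda>t. S1 t * (1 / t - 1 / r))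
       \<and> S2 r = (LBINT t:{r..}. S1 t * (1 / t - 1 / r))
       \<and> set_integrable lborel {r..} S1
       \<and> (\<lambda>n. V (real (Suc n) * r) / real (Suc n)) sums (LBINT t:{r..}. S1 t)"
proof -
  have w: "\<bar>1 / t - 1 / r\<bar> \<le> 1 / r" if "t \<ge> r" for t
    using that assms by (simp add: abs_if field_simps)
  have w_meas: "(\<lambda>t. 1 / t - 1 / r) \<in> borel_measurable borel" by measurable
  have R2: "(LBINT t:{r..}. R1 (real (Suc k) * t) * (1 / t - 1 / r)) = R2 (real (Suc k) * r)" for k
  proof -
    define c where "c = real (Suc k)"
    have c: "c > 0" by (simp add: c_def)
    have "R2 (c * r) = (LBINT u:{c * r..}. R1 u * (1 / u - 1 / (c * r)))"
      by (rule R2_eq_integral) (use c assms in simp)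
    also have "\<dots> = c * (LBINT t:{r..}. R1 (c * t) * (1 / (c * t) - 1 / (c * r)))"
      using set_integral_scale[OF c, of r "\<lambda>u. R1 u * (1 / u - 1 / (c * r))"] c by simp
    also have "\<dots> = (LBINT t:{r..}. c * (R1 (c * t) * (1 / (c * t) - 1 / (c * r))))"
      by (rule set_integral_mult_right[symmetric])
    \<comment> \<open>The weight is homogeneous of degree -1 in (t, r), so it absorbs the Jacobian
      \<open>c\<close>; for the constant weight the quotient by \<open>Suc k\<close> survives in the
      series of \<open>V\<close>.\<close>
    also have "(\<lambda>t. c * (R1 (c * t) * (1 / (c * t) - 1 / (c * r)))) = (\<lambda>t. R1 (c * t) * (1 / t - 1 / r))"
    proof
      fix t
      have "1 / (c * t) - 1 / (c * r) = (1 / t - 1 / r) / c" by (simp add: diff_divide_distrib mult.commute)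
      then show "c * (R1 (c * t) * (1 / (c * t) - 1 / (c * r))) = R1 (c * t) * (1 / t - 1 / r)"
        using c by simp
    qed
    finally show ?thesis by (simp add: c_def)
  qed
  have V: "(LBINT t:{r..}. R1 (real (Suc k) * t) * 1) = V (real (Suc k) * r) / real (Suc k)" for k
    using set_integral_scale[of "real (Suc k)" r R1] V_eq_integral[of "real (Suc k) * r"] assms
    by (simp del: of_nat_Suc)
  have "S2 r = (LBINT t:{r..}. S1 t * (1 / t - 1 / r))"
    using sums_integral_S1[OF assms w_meas w] unfolding R2 S2_def by (simp add: sums_iff)
  moreover have "(\<lambda>n. V (real (Suc n) * r) / real (Suc n)) sums (LBINT t:{r..}. S1 t)"
    using sums_integral_S1[OF assms, of "\<lambda>_. 1" 1] unfolding V by simp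
  moreover have "set_integrable lborel {r..} S1"
    using set_integrable_S1[OF assms, of "\<lambda>_. 1" 1] by simp
  ultimately show ?thesis using set_integrable_S1[OF assms w_meas w] by blast
qed

end
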